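(* For every positive integer $n$, the integer $\{2\}$-domination number of the grid graph $G_{3,n}$ satisfies $$\gamma_{\{2\}}(G_{3,n}) \le \left\lfloor\frac{3n}{2}\right\rfloor + 1.$$
   Context: For positive integers $m,n$, the grid graph $G_{m,n}=P_m\square P_n$ has vertex set $\{v_{i,j}: 1\le i\le m,\ 1\le j\le n\}$, where $v_{i_1,j_1}v_{i_2,j_2}$ is an edge iff ($|i_1-i_2|=1$ and $j_1=j_2$) or ($i_1=i_2$ and $|j_1-j_2|=1$). For a graph $G=(V,E)$ and $v\in V$, $N[v]$ denotes the closed neighborhood of $v$. An integer $\{2\}$-dominating function of $G$ is a function $f:V\to\mathbb{Z}_{\ge 0}$ with $\sum_{y\in N[x]} f(y)\ge 2$ for every $x\in V$; the integer $\{2\}$-domination number $\gamma_{\{2\}}(G)$ is the minimum of $\sum_{x\in V} f(x)$ over all integer $\{2\}$-dominating functions $f$ of $G$. *)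

theory Defs
  imports Complex_Main
begin

text \<open>A simple graph is given by its vertex set and its set of (two-element) edges.\<close>

type_synonym 'a graph = "'a set \<times> 'a set set"

definition vertices :: "'a graph \<Rightarrow> 'a set" where
  "vertices G = fst G"

definition edges :: "'a graph \<Rightarrow> 'a set set" where
  "edges G = snd G"

definition simple_graph :: "'a graph \<Rightarrow> bool" where
  "simple_graph G \<longleftrightarrow> finite (vertices G) \<and>
     (\<forall>e\<in>edges G. e \<subseteq> vertices G \<and> card e = 2)"

definition closed_neighborhood :: "'a graph \<Rightarrow> 'a \<Rightarrow> 'a set" where
  "closed_neighborhood G v = {v} \<union> {u \<in> vertices G. {u, v} \<in> edges G}"

text \<open>The vertex \<open>v\<^sub>i\<^sub>,\<^sub>j\<close> is the pair \<open>(i, j)\<close>. The differences are taken in the integers,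
  since subtraction on the naturals truncates.\<close>

definition grid_graph :: "nat \<Rightarrow> nat \<Rightarrow> (nat \<times> nat) graph" where
  "grid_graph m n =
     (let V = {1..m} \<times> {1..n} in
       (V, {{(i1, j1), (i2, j2)} | i1 j1 i2 j2.
             (i1, j1) \<in> V \<and> (i2, j2) \<in> V \<and>
             (\<bar>int i1 - int i2\<bar> = 1 \<and> j1 = j2 \<or> i1 = i2 \<and> \<bar>int j1 - int j2\<bar> = 1)}))"

text \<open>The type \<open>nat\<close> encodes nonnegativity. Values of \<open>f\<close> outside the vertex set are
  irrelevant: they enter neither the condition nor the weight.\<close>

definition two_dominating :: "'a graph \<Rightarrow> ('a \<Rightarrow> nat) \<Rightarrow> bool" where
  "two_dominating G f \<longleftrightarrow>
     (\<forall>x\<in>vertices G. (\<Sum>y\<in>closed_neighborhood G x. f y) \<ge> 2)"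

text \<open>The infimum is over a set of naturals; for finite graphs this set is nonempty, so the
  infimum is a minimum (lemma \<open>two_domination_number_attained\<close>).\<close>

definition two_domination_number :: "'a graph \<Rightarrow> nat" where
  "two_domination_number G =
     Inf {\<Sum>x\<in>vertices G. f x | f. two_dominating G f}"

lemma simple_graph_grid_graph: "simple_graph (grid_graph m n)"
  by (auto simp: simple_graph_def grid_graph_def vertices_def edges_def Let_def card_2_iff)
    force+

lemma grid_graph_adjacent_iff:
  "{(i1, j1), (i2, j2)} \<in> edges (grid_graph m n) \<longleftrightarrow>
     (i1, j1) \<in> {1..m} \<times> {1..n} \<and> (i2, j2) \<in> {1..m} \<times> {1..n} \<and>
     (\<bar>int i1 - int i2\<bar> = 1 \<and> j1 = j2 \<or> i1 = i2 \<and> \<bar>int j1 - int j2\<bar> = 1)"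
  unfolding grid_graph_def edges_def Let_def snd_conv mem_Collect_eq doubleton_eq_iff prod.inject
  by (auto simp: abs_minus_commute)

lemma two_domination_number_attained:
  assumes "simple_graph G"
  shows "\<exists>f. two_dominating G f \<and> (\<Sum>x\<in>vertices G. f x) = two_domination_number G"
proof -
  let ?S = "{\<Sum>x\<in>vertices G. f x | f. two_dominating G f}"
  have "two_dominating G (\<lambda>_. 2)"
    unfolding two_dominating_def
  proof
    fix x
    have "finite (closed_neighborhood G x)" "x \<in> closed_neighborhood G x"
      using assms by (auto simp: closed_neighborhood_def simple_graph_def)
    then have "card (closed_neighborhood G x) \<ge> 1"
      by (metis One_nat_def Suc_leI card_gt_0_iff empty_iff)
    then show "2 \<le> (\<Sum>y\<in>closed_neighborhood G x. 2::nat)" by simp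
  qed
  then have "?S \<noteq> {}" by blast
  then have "Inf ?S \<in> ?S" by (rule Inf_nat_def1)
  then show ?thesis unfolding two_domination_number_def by auto
qed

lemma two_domination_number_le:
  assumes "two_dominating G f"
  shows "two_domination_number G \<le> (\<Sum>x\<in>vertices G. f x)"
  unfolding two_domination_number_def using assms by (intro wellorder_Inf_le1) blast

end

theory Submission
  imports Defs
begin

text \<open>Put weight 1 on every vertex of the even columns, on the middle vertex of column 1 and, if
  \<open>n\<close> is odd, on the middle vertex of column \<open>n\<close>; for \<open>n = 1\<close> these two vertices coincide and
  receive weight 2. An interior odd column is dominated from its two neighbouring columns, an odd
  end column by its middle vertex and its one neighbouring column.\<close>

definition stripes :: "nat \<Rightarrow> nat \<times> nat \<Rightarrow> nat" where
  "stripes n = (\<lambda>(i, j). if even j then 1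
     else if i = 2 then of_bool (j = 1) + of_bool (j = n) else 0)"

lemma vertices_grid_graph: "vertices (grid_graph m n) = {1..m} \<times> {1..n}"
  by (simp add: vertices_def grid_graph_def Let_def)

lemma mem_closed_neighborhood_grid_graph:
  "(k, l) \<in> closed_neighborhood (grid_graph m n) (i, j) \<longleftrightarrow>
     k = i \<and> l = j \<or>
     (k, l) \<in> {1..m} \<times> {1..n} \<and> (i, j) \<in> {1..m} \<times> {1..n} \<and>
     (\<bar>int k - int i\<bar> = 1 \<and> l = j \<or> k = i \<and> \<bar>int l - int j\<bar> = 1)"
  by (auto simp: closed_neighborhood_def vertices_grid_graph grid_graph_adjacent_iff)

lemma finite_closed_neighborhood_grid_graph: "finite (closed_neighborhood (grid_graph m n) x)"
  by (simp add: closed_neighborhood_def vertices_grid_graph)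

text \<open>Every case of the domination proof except \<open>n = 1\<close> is settled by naming two
  distinct closed neighbours of positive weight.\<close>

lemma two_le_sumI:
  fixes f :: "'a \<Rightarrow> nat"
  assumes "finite N" "a \<in> N" "b \<in> N" "a \<noteq> b" "f a \<ge> 1" "f b \<ge> 1"
  shows "2 \<le> sum f N"
proof -
  have "2 \<le> sum f {a, b}" using assms by simp
  also have "\<dots> \<le> sum f N" using assms by (intro sum_mono2) auto
  finally show ?thesis .
qed

lemma two_dominating_stripes: "two_dominating (grid_graph 3 n) (stripes n)"
  unfolding two_dominating_def
proof (intro ballI, safe)
  fix i j assume v: "(i, j) \<in> vertices (grid_graph 3 n)"
  let ?N = "closed_neighborhood (grid_graph 3 n) (i, j)"
  have ij: "i = 1 \<or> i = 2 \<or> i = 3" "1 \<le> j" "j \<le> n"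
    using v by (auto simp: vertices_grid_graph)
  note mem = mem_closed_neighborhood_grid_graph
  note two_le = two_le_sumI[OF finite_closed_neighborhood_grid_graph]
  consider "even j" | "n = 1" | "odd j" "j = 1" "n > 1" | "odd j" "j = n" "n > 1"
    | "odd j" "1 < j" "j < n"
    using ij by linarith
  then show "2 \<le> sum (stripes n) ?N"
  proof cases
    case 1
    show ?thesis
      \<comment> \<open>The whole column has weight 1, so the vertex and a vertical neighbour
        suffice.\<close>
      by (rule two_le[where a = "(i, j)" and b = "(if i = 2 then 1 else 2, j)"])
        (use ij 1 in \<open>auto simp: mem stripes_def\<close>)
  next
    case 2
    \<comment> \<open>Only one vertex has positive weight here; both \<open>of_bool\<close> terms
      hold there, so it contributes 2 alone.\<close>
    have "(2, 1) \<in> ?N" using ij 2 by (auto simp: mem)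
    then have "stripes n (2, 1) \<le> sum (stripes n) ?N"
      by (intro member_le_sum) (auto simp: finite_closed_neighborhood_grid_graph)
    then show ?thesis using 2 by (simp add: stripes_def)
  next
    case 3
    show ?thesis
      \<comment> \<open>The middle vertex lies in the closed neighbourhood of every vertex of its
        column; column \<open>j + 1\<close> is even and exists as \<open>n > 1\<close>.\<close>
      by (rule two_le[where a = "(2, j)" and b = "(i, j + 1)"])
        (use ij 3 in \<open>auto simp: mem stripes_def\<close>)
  next
    case 4
    show ?thesis
      by (rule two_le[where a = "(2, j)" and b = "(i, j - 1)"])
        (use ij 4 in \<open>auto simp: mem stripes_def\<close>)
  next
    case 5
    show ?thesis
      by (rule two_le[where a = "(i, j - 1)" and b = "(i, j + 1)"])
        (use ij 5 in \<open>auto simp: mem stripes_def\<close>)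
  qed
qed

lemma sum_of_bool_even: "(\<Sum>j=1..n. of_bool (even j)) = n div 2" for n :: nat
  by (induction n) auto

text \<open>The \<open>n div 2\<close> even columns weigh 3 each, the left end adds 1, and the right
  end adds 1 exactly when \<open>n\<close> is odd, which makes up for the rounding in
  \<open>n div 2\<close>.\<close>

lemma sum_stripes:
  assumes "n \<ge> 1"
  shows "(\<Sum>x\<in>vertices (grid_graph 3 n). stripes n x) = 3 * n div 2 + 1"
proof -
  \<comment> \<open>The factor \<open>of_bool (odd n)\<close> is there because an even last column
    is already counted in full.\<close>
  have column: "(\<Sum>i\<in>{1..3}. stripes n (i, j)) =
      3 * of_bool (even j) + (if j = 1 then 1 else 0) + (if j = n then of_bool (odd n) else 0)"
    for j
    by (auto simp: stripes_def numeral_3_eq_3)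
  have "(\<Sum>x\<in>vertices (grid_graph 3 n). stripes n x) = (\<Sum>j=1..n. \<Sum>i\<in>{1..3}. stripes n (i, j))"
    unfolding vertices_grid_graph sum.cartesian_product' by (rule sum.swap)
  also have "\<dots> = 3 * (n div 2) + 1 + of_bool (odd n)"
    using assms unfolding column sum.distrib sum_distrib_left[symmetric] sum_of_bool_even by simp
  also have "\<dots> = 3 * n div 2 + 1"
    by (cases "even n") (auto elim!: evenE oddE)
  finally show ?thesis .
qed

theorem theorem2p4:
  fixes n :: nat
  assumes "n \<ge> 1"
  shows "int (two_domination_number (grid_graph 3 n)) \<le> \<lfloor>3 * real n / 2\<rfloor> + 1"
proof -
  have "two_domination_number (grid_graph 3 n) \<le> 3 * n div 2 + 1"
    using two_domination_number_le[OF two_dominating_stripes] sum_stripes[OF assms] by metis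
  moreover have "\<lfloor>3 * real n / 2\<rfloor> = int (3 * n div 2)"
    using floor_divide_of_nat_eq[of "3 * n" 2, where 'a = real] by simp
  ultimately show ?thesis by linarith
qed

end
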